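(* All four point queue models PQM1, PQM2, PQM3, PQM4 are well-defined. That is, for each of the four choices of demand and supply functions, $\lambda(t)$ is always between $0$ and $\Lambda$ in the formulation $$\frac{d}{dt}\lambda(t)=\min\{\delta(t),s(t)\}-\min\{d(t),\sigma(t)\},$$ and $G(t)\le F(t)\le G(t)+\Lambda$ always holds in the formulation $$\frac{d}{dt}F(t)=\min\{\delta(t),s(t)\},\qquad \frac{d}{dt}G(t)=\min\{d(t),\sigma(t)\}.$$
   Context: A point queue has storage capacity $\Lambda>0$, origin demand $\delta(t)\ge0$, destination supply $\sigma(t)\ge0$ (continuous functions of $t\ge0$), and initial size $\Lambda_0\in[0,\Lambda]$. The queue size is $\lambda(t)$, and $F(t),G(t)$ are the cumulative in- and out-flows, with $\lambda(t)=F(t)-G(t)$, $F(0)=\Lambda_0$, $G(0)=0$, $\lambda(0)=\Lambda_0$. For $y\ge0$, $H(y)=\lim_{\Delta t\to0^+}\frac{y}{\Delta t}$, i.e. $H(0)=0$ and $H(y)=\infty$ for $y>0$. The demand $d(t)$ and supply $s(t)$ of the four models are: - PQM1: $d=\delta(t)+H(\lambda(t))$, $s=\sigma(t)+H(\Lambda-\lambda(t))$; - PQM2: $d=H(\lambda(t))$, $s=H(\Lambda-\lambda(t))$; - PQM3: $d=\delta(t)+H(\lambda(t))$, $s=H(\Lambda-\lambda(t))$; - PQM4: $d=H(\lambda(t))$, $s=\sigma(t)+H(\Lambda-\lambda(t))$. Each model has two formulations: (A) with state variable $\lambda$, $\frac{d}{dt}\lambda=\min\{\delta,s\}-\min\{d,\sigma\}$;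 (B) with state variables $F,G$, $\frac{d}{dt}F=\min\{\delta,s\}$, $\frac{d}{dt}G=\min\{d,\sigma\}$, where $\lambda$ is replaced by $F-G$ in $d$ and $s$. Right-hand sides may be discontinuous and solutions need not be differentiable everywhere; the equations are understood in integrated form. A continuous point queue model is called well-defined if and only if $\lambda(t)$ is always between $0$ and $\Lambda$ in formulation (A), or $G(t)\le F(t)\le G(t)+\Lambda$ in formulation (B). *)

theory Defs
  imports "HOL-Analysis.Analysis"
begin

text \<open>
  \<open>H y\<close> is the limit of \<open>y / h\<close> for \<open>h \<rightarrow> 0+\<close> in the extended reals, for \<open>y \<ge> 0\<close>.
  The dynamics have to make sense before one knows that the queue size \<open>q\<close> stays in
  \<open>[0, \<Lambda>]\<close>, so \<open>H\<close> has to be extended to negative arguments. Any extension with values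
  \<open>\<le> 0\<close> is admitted; this includes the constant \<open>0\<close> and the value \<open>-\<infinity>\<close> which the
  limit formula itself gives for \<open>y < 0\<close>.
\<close>

definition release_rate :: "(real \<Rightarrow> ereal) \<Rightarrow> bool" where
  "release_rate H \<longleftrightarrow>
     (\<forall>y\<ge>0. ((\<lambda>h. ereal (y / h)) \<longlongrightarrow> H y) (at_right 0)) \<and> (\<forall>y<0. H y \<le> 0)"

lemma release_rate_iff:
  "release_rate H \<longleftrightarrow> H 0 = 0 \<and> (\<forall>y>0. H y = \<infinity>) \<and> (\<forall>y<0. H y \<le> 0)"
proof -
  have zero: "((\<lambda>h. ereal (0 / h)) \<longlongrightarrow> 0) (at_right (0::real))"
    by (simp add: zero_ereal_def)
  have pos: "((\<lambda>h. ereal (y / h)) \<longlongrightarrow> \<infinity>) (at_right 0)" if "y > 0" for y :: real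
  proof -
    have "filterlim (\<lambda>h. y * inverse h) at_top (at_right (0::real))"
      using that by (intro filterlim_tendsto_pos_mult_at_top[OF tendsto_const]
          filterlim_inverse_at_top_right)
    then show ?thesis
      by (simp add: tendsto_PInfty_eq_at_top divide_inverse)
  qed
  have lim: "((\<lambda>h. ereal (y / h)) \<longlongrightarrow> a) (at_right 0) \<longleftrightarrow> a = (if y = 0 then 0 else \<infinity>)"
    if "y \<ge> 0" for y :: real and a
    using zero pos[of y] that tendsto_unique[OF trivial_limit_at_right_real] by force
  show ?thesis
    unfolding release_rate_def using lim by (smt (verit, best))
qed

datatype pqm = PQM1 | PQM2 | PQM3 | PQM4

fun queue_demand :: "(real \<Rightarrow> ereal) \<Rightarrow> pqm \<Rightarrow> real \<Rightarrow> real \<Rightarrow> ereal" where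
  "queue_demand H PQM1 \<delta> q = ereal \<delta> + H q"
| "queue_demand H PQM2 \<delta> q = H q"
| "queue_demand H PQM3 \<delta> q = ereal \<delta> + H q"
| "queue_demand H PQM4 \<delta> q = H q"

fun queue_supply :: "(real \<Rightarrow> ereal) \<Rightarrow> pqm \<Rightarrow> real \<Rightarrow> real \<Rightarrow> real \<Rightarrow> ereal" where
  "queue_supply H PQM1 \<Lambda> \<sigma> q = ereal \<sigma> + H (\<Lambda> - q)"
| "queue_supply H PQM2 \<Lambda> \<sigma> q = H (\<Lambda> - q)"
| "queue_supply H PQM3 \<Lambda> \<sigma> q = H (\<Lambda> - q)"
| "queue_supply H PQM4 \<Lambda> \<sigma> q = ereal \<sigma> + H (\<Lambda> - q)"

definition inflow ::
  "(real \<Rightarrow> ereal) \<Rightarrow> pqm \<Rightarrow> real \<Rightarrow> (real \<Rightarrow> real) \<Rightarrow> (real \<Rightarrow> real) \<Rightarrow> (real \<Rightarrow> real) \<Rightarrow> real \<Rightarrow> ereal"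
  where "inflow H m \<Lambda> \<delta> \<sigma> q t = min (ereal (\<delta> t)) (queue_supply H m \<Lambda> (\<sigma> t) (q t))"

definition outflow ::
  "(real \<Rightarrow> ereal) \<Rightarrow> pqm \<Rightarrow> (real \<Rightarrow> real) \<Rightarrow> (real \<Rightarrow> real) \<Rightarrow> (real \<Rightarrow> real) \<Rightarrow> real \<Rightarrow> ereal"
  where "outflow H m \<delta> \<sigma> q t = min (queue_demand H m (\<delta> t) (q t)) (ereal (\<sigma> t))"

text \<open>
  The equation \<open>dx/dt = r\<close>, \<open>x(0) = x0\<close> on \<open>[0, T]\<close> in integrated form. The horizon \<open>T\<close>
  is arbitrary: the right-hand sides are discontinuous, and a solution need not extend to
  all of \<open>[0, \<infinity>)\<close>; a global solution is a solution for every \<open>T\<close>.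
  The right-hand side is extended-real valued and has to be finite almost everywhere; \<open>v\<close> is its real-valued
  version. The integral is the Henstock-Kurzweil integral, so Lebesgue
  (Caratheodory) solutions are included.
\<close>

definition integrated_ode :: "real \<Rightarrow> (real \<Rightarrow> ereal) \<Rightarrow> real \<Rightarrow> (real \<Rightarrow> real) \<Rightarrow> bool" where
  "integrated_ode T r x0 x \<longleftrightarrow>
     (\<exists>v. (AE t in lebesgue. t \<in> {0..T} \<longrightarrow> r t = ereal (v t)) \<and>
          (\<forall>t\<in>{0..T}. (v has_integral (x t - x0)) {0..t}))"

definition solution_A ::
  "real \<Rightarrow> (real \<Rightarrow> ereal) \<Rightarrow> pqm \<Rightarrow> real \<Rightarrow> real \<Rightarrow> (real \<Rightarrow> real) \<Rightarrow> (real \<Rightarrow> real) \<Rightarrow> (real \<Rightarrow> real) \<Rightarrow> bool"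
  where "solution_A T H m \<Lambda> \<Lambda>0 \<delta> \<sigma> q \<longleftrightarrow>
    integrated_ode T (\<lambda>t. inflow H m \<Lambda> \<delta> \<sigma> q t - outflow H m \<delta> \<sigma> q t) \<Lambda>0 q"

definition solution_B ::
  "real \<Rightarrow> (real \<Rightarrow> ereal) \<Rightarrow> pqm \<Rightarrow> real \<Rightarrow> real \<Rightarrow> (real \<Rightarrow> real) \<Rightarrow> (real \<Rightarrow> real)
    \<Rightarrow> (real \<Rightarrow> real) \<Rightarrow> (real \<Rightarrow> real) \<Rightarrow> bool"
  where "solution_B T H m \<Lambda> \<Lambda>0 \<delta> \<sigma> F G \<longleftrightarrow>
    integrated_ode T (inflow H m \<Lambda> \<delta> \<sigma> (\<lambda>t. F t - G t)) \<Lambda>0 F \<and>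
    integrated_ode T (outflow H m \<delta> \<sigma> (\<lambda>t. F t - G t)) 0 G"

definition well_defined_A ::
  "(real \<Rightarrow> ereal) \<Rightarrow> pqm \<Rightarrow> real \<Rightarrow> real \<Rightarrow> (real \<Rightarrow> real) \<Rightarrow> (real \<Rightarrow> real) \<Rightarrow> bool"
  where "well_defined_A H m \<Lambda> \<Lambda>0 \<delta> \<sigma> \<longleftrightarrow>
    (\<forall>T\<ge>0. \<forall>q. solution_A T H m \<Lambda> \<Lambda>0 \<delta> \<sigma> q \<longrightarrow> (\<forall>t\<in>{0..T}. 0 \<le> q t \<and> q t \<le> \<Lambda>))"

definition well_defined_B ::
  "(real \<Rightarrow> ereal) \<Rightarrow> pqm \<Rightarrow> real \<Rightarrow> real \<Rightarrow> (real \<Rightarrow> real) \<Rightarrow> (real \<Rightarrow> real) \<Rightarrow> bool"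
  where "well_defined_B H m \<Lambda> \<Lambda>0 \<delta> \<sigma> \<longleftrightarrow>
    (\<forall>T\<ge>0. \<forall>F G. solution_B T H m \<Lambda> \<Lambda>0 \<delta> \<sigma> F G \<longrightarrow> (\<forall>t\<in>{0..T}. G t \<le> F t \<and> F t \<le> G t + \<Lambda>))"

end

theory Submission
  imports Defs
begin

text \<open>
  Below the level \<open>0\<close> the buffer has ample supply, so the inflow is the full origin demand
  \<open>\<delta>\<close>, while the outflow is at most \<open>\<delta>\<close>; above \<open>\<Lambda>\<close> the outflow is the full
  destination supply \<open>\<sigma>\<close>, while the inflow is at most \<open>\<sigma>\<close>. So the queue size, a continuous
  function, can only move back towards \<open>[0, \<Lambda>]\<close> after its last visit there, which rules out
  any excursion. The flow formulation reduces to the queue formulation by subtraction.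
\<close>

text \<open>Changing \<open>f\<close> to 0 on the exceptional null set leaves the integral unchanged
  and makes the integrand nonnegative everywhere on \<open>S\<close>.\<close>

lemma has_integral_nonneg_AE:
  fixes f :: "real \<Rightarrow> real"
  assumes "(f has_integral i) S" and "AE t in lebesgue. t \<in> S \<longrightarrow> 0 \<le> f t"
  shows "0 \<le> i"
proof -
  obtain N where N: "\<And>t. t \<in> space lebesgue - N \<Longrightarrow> t \<in> S \<longrightarrow> 0 \<le> f t" "N \<in> null_sets lebesgue"
    using AE_E3[OF assms(2)] by blast
  have "((\<lambda>t. if t \<in> N then 0 else f t) has_integral i) S"
    by (rule has_integral_spike[OF N(2)[folded negligible_iff_null_sets] _ assms(1)]) simp
  then show ?thesis
    by (rule has_integral_nonneg) (use N(1) in simp)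
qed

text \<open>Reflection: it turns an upper bound for a solution into a lower bound, so that one
  barrier lemma serves both ends of the buffer.\<close>

lemma integrated_ode_uminus:
  assumes "integrated_ode T r x0 x"
  shows "integrated_ode T (\<lambda>t. - r t) (- x0) (\<lambda>t. - x t)"
proof -
  obtain v where r: "AE t in lebesgue. t \<in> {0..T} \<longrightarrow> r t = ereal (v t)"
    and v: "\<And>t. t \<in> {0..T} \<Longrightarrow> (v has_integral (x t - x0)) {0..t}"
    using assms unfolding integrated_ode_def by blast
  from r have "AE t in lebesgue. t \<in> {0..T} \<longrightarrow> - r t = ereal (- v t)"
    by eventually_elim auto
  moreover have "((\<lambda>t. - v t) has_integral (- x t - - x0)) {0..t}" if "t \<in> {0..T}" for t
    using has_integral_neg[OF v[OF that]] by simp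
  ultimately show ?thesis
    unfolding integrated_ode_def by (intro exI conjI ballI)
qed

text \<open>Both rates are finite almost everywhere on \<open>{0..T}\<close>, so the extended-real
  subtraction agrees there with the real one and linearity of the integral applies.\<close>

lemma integrated_ode_diff:
  assumes "integrated_ode T r x0 x" "integrated_ode T s y0 y"
  shows "integrated_ode T (\<lambda>t. r t - s t) (x0 - y0) (\<lambda>t. x t - y t)"
proof -
  obtain v where r: "AE t in lebesgue. t \<in> {0..T} \<longrightarrow> r t = ereal (v t)"
    and v: "\<And>t. t \<in> {0..T} \<Longrightarrow> (v has_integral (x t - x0)) {0..t}"
    using assms(1) unfolding integrated_ode_def by blast
  obtain w where s: "AE t in lebesgue. t \<in> {0..T} \<longrightarrow> s t = ereal (w t)"
    and w: "\<And>t. t \<in> {0..T} \<Longrightarrow> (w has_integral (y t - y0)) {0..t}"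
    using assms(2) unfolding integrated_ode_def by blast
  from r s have "AE t in lebesgue. t \<in> {0..T} \<longrightarrow> r t - s t = ereal (v t - w t)"
    by eventually_elim auto
  moreover have "((\<lambda>t. v t - w t) has_integral (x t - y t - (x0 - y0))) {0..t}"
    if "t \<in> {0..T}" for t
    using has_integral_diff[OF v[OF that] w[OF that]] by (simp add: algebra_simps)
  ultimately show ?thesis
    unfolding integrated_ode_def by (intro exI conjI ballI)
qed

lemma integrated_ode_lower_barrier:
  assumes ode: "integrated_ode T r x0 x"
    and init: "c \<le> x0"
    and push: "\<And>t. t \<in> {0..T} \<Longrightarrow> x t < c \<Longrightarrow> 0 \<le> r t"
    and t: "t \<in> {0..T}"
  shows "c \<le> x t"
proof (rule ccontr)
  assume "\<not> c \<le> x t"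
  then have below: "x t < c" by simp
  obtain v where AE: "AE t in lebesgue. t \<in> {0..T} \<longrightarrow> r t = ereal (v t)"
    and v: "\<And>t. t \<in> {0..T} \<Longrightarrow> (v has_integral (x t - x0)) {0..t}"
    using ode unfolding integrated_ode_def by blast
  have x0: "x 0 = x0"
    using integral_unique[OF v[of 0]] t by simp
  \<comment> \<open>Continuity is not assumed: \<open>x\<close> inherits it as an indefinite
    integral.\<close>
  have cont: "continuous_on {0..t} x"
  proof -
    have "continuous_on {0..t} (\<lambda>u. x0 + integral {0..u} v)"
      using v[OF t] by (intro continuous_intros indefinite_integral_continuous_1) blast
    moreover have "x0 + integral {0..u} v = x u" if "u \<in> {0..t}" for u
      using integral_unique[OF v[of u]] that t by auto
    ultimately show ?thesis
      by (rule continuous_on_eq)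
  qed
  \<comment> \<open>The times up to \<open>t\<close> at which \<open>x\<close> is at or above the
    barrier. This set is closed and contains 0, so its supremum is attained: it is the last such
    time.\<close>
  define S where "S = {0..t} \<inter> x -` {c..}"
  have "closed S"
    unfolding S_def by (intro continuous_closed_preimage cont) auto
  moreover have "0 \<in> S" "bdd_above S"
    using t init x0 by (auto simp: S_def intro: bdd_aboveI)
  ultimately have s: "Sup S \<in> S"
    using closed_contains_Sup[of S] by blast
  define s where "s = Sup S"
  have s: "0 \<le> s" "s \<le> t" "c \<le> x s"
    using s by (auto simp: S_def s_def)
  have after: "x u < c" if "s < u" "u \<le> t" for u
  proof (rule ccontr)
    assume "\<not> x u < c"
    with that s have "u \<in> S" by (simp add: S_def)
    then have "u \<le> s" unfolding s_def by (rule cSup_upper) fact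
    with that show False by simp
  qed
  have "(v has_integral (x t - x s)) {s..t}"
  proof -
    have int: "v integrable_on {s..t}"
      by (rule integrable_on_subinterval[OF has_integral_integrable[OF v[OF t]]]) (use s in auto)
    have "(v has_integral (x s - x0 + integral {s..t} v)) {0..t}"
      using s t by (intro has_integral_combine[OF s(1,2)] v integrable_integral int) auto
    then have "x s - x0 + integral {s..t} v = x t - x0"
      using v[OF t] by (rule has_integral_unique)
    then have "integral {s..t} v = x t - x s" by simp
    with integrable_integral[OF int] show ?thesis by simp
  qed
  moreover have "AE u in lebesgue. u \<in> {s..t} \<longrightarrow> 0 \<le> v u"
  proof -
    \<comment> \<open>At \<open>s\<close> itself \<open>x\<close> is still at least
      \<open>c\<close>, so \<open>push\<close> says nothing there; a single point is
      negligible.\<close>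
    have "AE u in lebesgue. u \<noteq> s"
      using AE_not_in[OF negligible_sing[of s, unfolded negligible_iff_null_sets]] by simp
    with AE show ?thesis
    proof eventually_elim
      case (elim u)
      show ?case
      proof
        assume "u \<in> {s..t}"
        then have "u \<in> {0..T}" "x u < c"
          using after[of u] elim s t by auto
        with push[of u] elim show "0 \<le> v u" by simp
      qed
    qed
  qed
  ultimately have "0 \<le> x t - x s"
    by (rule has_integral_nonneg_AE)
  with s below show False by simp
qed

text \<open>With a negative queue the free space is positive, so the supply is infinite in every
  model and the inflow is all of \<open>\<delta> t\<close>.\<close>

lemma flow_balance_below:
  assumes "release_rate H" "\<Lambda> > 0" "q t < 0" "\<delta> t \<ge> 0"
  shows "0 \<le> inflow H m \<Lambda> \<delta> \<sigma> q t - outflow H m \<delta> \<sigma> q t"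
proof -
  have H: "H (q t) \<le> 0" "H (\<Lambda> - q t) = \<infinity>"
    using assms by (auto simp: release_rate_iff)
  have "inflow H m \<Lambda> \<delta> \<sigma> q t = \<delta> t"
    by (cases m) (auto simp: inflow_def H)
  \<comment> \<open>The demand is either \<open>\<delta> t + H (q t)\<close> or
    \<open>H (q t)\<close>. As \<open>H (q t)\<close> is at most 0, monotonicity of addition settles
    the first form and \<open>0 \<le> \<delta> t\<close> the second.\<close>
  moreover have "queue_demand H m (\<delta> t) (q t) \<le> \<delta> t"
    using H(1) assms(4) add_left_mono[OF H(1), of "ereal (\<delta> t)"] order_trans[OF H(1), of "ereal (\<delta> t)"]
    by (cases m) auto
  then have "outflow H m \<delta> \<sigma> q t \<le> \<delta> t"
    by (simp add: outflow_def min.coboundedI1)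
  ultimately show ?thesis
    \<comment> \<open>The outflow may be minus infinity, since \<open>H\<close> may take that value
      at negative arguments; the difference is then plus infinity.\<close>
    by (cases "outflow H m \<delta> \<sigma> q t") auto
qed

text \<open>Mirror image of \<open>flow_balance_below\<close>: inflow and outflow,
  \<open>\<delta>\<close> and \<open>\<sigma>\<close>, queue size and free space change
  places.\<close>

lemma flow_balance_above:
  assumes "release_rate H" "\<Lambda> > 0" "\<Lambda> < q t" "\<sigma> t \<ge> 0"
  shows "inflow H m \<Lambda> \<delta> \<sigma> q t - outflow H m \<delta> \<sigma> q t \<le> 0"
proof -
  have H: "H (\<Lambda> - q t) \<le> 0" "H (q t) = \<infinity>"
    using assms by (auto simp: release_rate_iff)
  have "outflow H m \<delta> \<sigma> q t = \<sigma> t"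
    by (cases m) (auto simp: outflow_def H)
  moreover have "queue_supply H m \<Lambda> (\<sigma> t) (q t) \<le> \<sigma> t"
    using H(1) assms(4) add_left_mono[OF H(1), of "ereal (\<sigma> t)"] order_trans[OF H(1), of "ereal (\<sigma> t)"]
    by (cases m) auto
  then have "inflow H m \<Lambda> \<delta> \<sigma> q t \<le> \<sigma> t"
    by (simp add: inflow_def min.coboundedI2)
  ultimately show ?thesis
    by (cases "inflow H m \<Lambda> \<delta> \<sigma> q t") auto
qed

lemma solution_B_imp_solution_A:
  assumes "solution_B T H m \<Lambda> \<Lambda>0 \<delta> \<sigma> F G"
  shows "solution_A T H m \<Lambda> \<Lambda>0 \<delta> \<sigma> (\<lambda>t. F t - G t)"
  using integrated_ode_diff[OF assms[unfolded solution_B_def, THEN conjunct1]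
      assms[unfolded solution_B_def, THEN conjunct2]]
  by (simp add: solution_A_def)

theorem theorem3p5:
  fixes \<Lambda> \<Lambda>0 :: real and \<delta> \<sigma> :: "real \<Rightarrow> real" and H :: "real \<Rightarrow> ereal" and m :: pqm
  assumes "release_rate H"
    and "\<Lambda> > 0" and "0 \<le> \<Lambda>0" and "\<Lambda>0 \<le> \<Lambda>"
    and "continuous_on {0..} \<delta>" and "\<And>t. t \<ge> 0 \<Longrightarrow> \<delta> t \<ge> 0"
    and "continuous_on {0..} \<sigma>" and "\<And>t. t \<ge> 0 \<Longrightarrow> \<sigma> t \<ge> 0"
  shows "well_defined_A H m \<Lambda> \<Lambda>0 \<delta> \<sigma> \<and> well_defined_B H m \<Lambda> \<Lambda>0 \<delta> \<sigma>"
proof -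
  have bounds: "0 \<le> q t \<and> q t \<le> \<Lambda>"
    if sol: "solution_A T H m \<Lambda> \<Lambda>0 \<delta> \<sigma> q" and t: "t \<in> {0..T}" for T q t
  proof -
    let ?r = "\<lambda>t. inflow H m \<Lambda> \<delta> \<sigma> q t - outflow H m \<delta> \<sigma> q t"
    have ode: "integrated_ode T ?r \<Lambda>0 q"
      using sol by (simp add: solution_A_def)
    have "0 \<le> q t"
      by (rule integrated_ode_lower_barrier[OF ode \<open>0 \<le> \<Lambda>0\<close> _ t])
        (use assms in \<open>auto intro: flow_balance_below\<close>)
    \<comment> \<open>The upper bound is the lower barrier \<open>- \<Lambda>\<close> for the
      reflected solution \<open>- q\<close>.\<close>
    moreover have "- \<Lambda> \<le> - q t"
    proof (rule integrated_ode_lower_barrier[OF integrated_ode_uminus[OF ode] _ _ t])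
      fix u assume "u \<in> {0..T}" "- q u < - \<Lambda>"
      then show "0 \<le> - ?r u"
        using flow_balance_above[of H \<Lambda> q u \<sigma> m \<delta>] assms by simp
    qed (use assms in simp)
    ultimately show ?thesis by simp
  qed
  then have "well_defined_A H m \<Lambda> \<Lambda>0 \<delta> \<sigma>"
    by (simp add: well_defined_A_def)
  moreover have "well_defined_B H m \<Lambda> \<Lambda>0 \<delta> \<sigma>"
    unfolding well_defined_B_def
    using bounds[OF solution_B_imp_solution_A] by (force simp: algebra_simps)
  ultimately show ?thesis ..
qed

end
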